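(* Let $C\subset\mathbb R^d$ be a compact set and let $\{\varphi_i\}_{i=1}^{\kappa}$ be a similitude iterated function system on $\mathbb R^d$ satisfying the condensation open set condition with condensation $C$. If $E$ is the associated self-similar set and $E_C$ is the inhomogeneous self-similar set with condensation $C$, then $$\overline{\dim}_{\mathrm A}(E_C)=\max\{\overline{\dim}_{\mathrm A}(E),\overline{\dim}_{\mathrm A}(C)\}.$$
   Context: A similitude iterated function system (IFS) is a finite collection $\{\varphi_i\}_{i=1}^\kappa$ of contractive similitudes of $\mathbb R^d$. The associated self-similar set is the unique nonempty compact set $E\subset\mathbb R^d$ with $E=\bigcup_{i=1}^\kappa\varphi_i(E)$. For a compact set $C\subset\mathbb R^d$, the inhomogeneous self-similar set with condensation $C$ is the unique nonempty compact set $E_C\subset\mathbb R^d$ with $E_C=\bigcup_{i=1}^\kappa\varphi_i(E_C)\cup C$ (so $E_\emptyset=E$). Condensation open set condition (COSC) with condensation $C$: there exists a nonempty open set $U\subset\mathbb R^d$ such that $C\subset U\setminus\bigcup_i\overline{\varphi_i(U)}$, $\varphi_i(U)\subset U$ for all $i$, and $\varphi_i(U)\cap\varphi_j(U)=\emptyset$ whenever $i\ne j$. (Upper) Assouad dimension $\overline{\dim}_{\mathrm A}(A)$ of a set $A\subset\mathbb R^d$, regarded as a metric space with the restricted metric: the infimum of all $s\ge0$ for which there is a constant $c\ge1$ such that for all $x\in A$ and $0<r<R<\operatorname{diam}(A)$ the closed ball $B(x,R)$ of $A$ can be covered by at most $c(r/R)^{-s}$ balls of radius $r$. (For a one-point set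 the restriction $R<\operatorname{diam}(A)$ is removed.) *)

theory Defs
  imports "HOL-Analysis.Analysis"
begin

definition contractive_similitude :: "('a::metric_space \<Rightarrow> 'a) \<Rightarrow> bool" where
  "contractive_similitude f \<longleftrightarrow>
     (\<exists>\<rho>. 0 < \<rho> \<and> \<rho> < 1 \<and> (\<forall>x y. dist (f x) (f y) = \<rho> * dist x y))"

text \<open>An iterated function system \<open>\<phi>\<^sub>1, \<dots>, \<phi>\<^sub>\<kappa>\<close> is given by \<open>\<kappa>\<close> and the family \<open>\<phi>\<close>;
  the values of \<open>\<phi>\<close> outside \<open>{1..\<kappa>}\<close> are irrelevant.\<close>

definition similitude_IFS :: "nat \<Rightarrow> (nat \<Rightarrow> 'a::metric_space \<Rightarrow> 'a) \<Rightarrow> bool" where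
  "similitude_IFS \<kappa> \<phi> \<longleftrightarrow> (\<forall>i\<in>{1..\<kappa>}. contractive_similitude (\<phi> i))"

text \<open>The next two predicates determine the set uniquely for a similitude IFS with \<open>\<kappa> \<ge> 1\<close>
  on Euclidean space and compact \<open>C\<close>. There is no self-similar set if \<open>\<kappa> = 0\<close>.\<close>

definition self_similar_set ::
  "nat \<Rightarrow> (nat \<Rightarrow> 'a::metric_space \<Rightarrow> 'a) \<Rightarrow> 'a set \<Rightarrow> bool" where
  "self_similar_set \<kappa> \<phi> E \<longleftrightarrow>
     compact E \<and> E \<noteq> {} \<and> E = (\<Union>i\<in>{1..\<kappa>}. \<phi> i ` E)"

definition inhomogeneous_self_similar_set ::
  "nat \<Rightarrow> (nat \<Rightarrow> 'a::metric_space \<Rightarrow> 'a) \<Rightarrow> 'a set \<Rightarrow> 'a set \<Rightarrow> bool" where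
  "inhomogeneous_self_similar_set \<kappa> \<phi> C K \<longleftrightarrow>
     compact K \<and> K \<noteq> {} \<and> K = (\<Union>i\<in>{1..\<kappa>}. \<phi> i ` K) \<union> C"

definition condensation_open_set_condition ::
  "nat \<Rightarrow> (nat \<Rightarrow> 'a::metric_space \<Rightarrow> 'a) \<Rightarrow> 'a set \<Rightarrow> bool" where
  "condensation_open_set_condition \<kappa> \<phi> C \<longleftrightarrow>
     (\<exists>U. open U \<and> U \<noteq> {} \<and>
        C \<subseteq> U - (\<Union>i\<in>{1..\<kappa>}. closure (\<phi> i ` U)) \<and>
        (\<forall>i\<in>{1..\<kappa>}. \<phi> i ` U \<subseteq> U) \<and>
        (\<forall>i\<in>{1..\<kappa>}. \<forall>j\<in>{1..\<kappa>}. i \<noteq> j \<longrightarrow> \<phi> i ` U \<inter> \<phi> j ` U = {}))"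

text \<open>The balls are those of the metric space \<open>A\<close>, so their centres lie in \<open>A\<close>.
  The library's \<open>diameter\<close> is \<open>0\<close> on unbounded sets, hence the guard \<open>bounded A\<close>:
  for unbounded \<open>A\<close> the condition \<open>R < diam A\<close> is no restriction.\<close>

definition assouad_exponent :: "'a::metric_space set \<Rightarrow> real \<Rightarrow> bool" where
  "assouad_exponent A s \<longleftrightarrow>
     (\<exists>c\<ge>1. \<forall>x\<in>A. \<forall>r R.
        0 < r \<and> r < R \<and> (bounded A \<and> \<not> is_singleton A \<longrightarrow> R < diameter A) \<longrightarrow>
        (\<exists>F. finite F \<and> F \<subseteq> A \<and> real (card F) \<le> c * (r / R) powr (- s) \<and>
             cball x R \<inter> A \<subseteq> (\<Union>y\<in>F. cball y r \<inter> A)))"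

definition assouad_dim :: "'a::metric_space set \<Rightarrow> ereal" where
  "assouad_dim A = Inf (ereal ` {s. 0 \<le> s \<and> assouad_exponent A s})"

end

theory Submission
  imports Defs
begin

text \<open>Up to an error comparable to \<open>r\<close>, the inhomogeneous set consists of \<open>E\<close> and of the copies
  \<open>\<phi>\<^sub>w(C)\<close> with \<open>\<rho>\<^sub>w > r\<close>. The condensation open set condition makes all these copies, for
  comparable and incomparable words alike, separated relative to their sizes. Hence boundedly many
  copies larger than \<open>R\<close> meet \<open>B(x, R)\<close>, and those of size about \<open>R / 2\<^sup>n\<close> meeting \<open>B(x, R)\<close> are at
  most about \<open>2\<^bsup>nt'\<^esup>\<close> in number for every exponent \<open>t'\<close> of \<open>E\<close>. If \<open>t > t'\<close> is an exponent of \<open>C\<close>,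
  each of the latter needs about \<open>(R / (2\<^sup>n r))\<^bsup>t\<^esup>\<close> balls of radius \<open>r\<close>, and the sum
  over \<open>n\<close> is geometric.\<close>

section \<open>Finite coverings with counted balls\<close>

text \<open>The bound \<open>k\<close> is real so that expressions such as
  \<open>c * (R / r) powr s\<close> can be inserted directly. The centres lie in \<open>A\<close>,
  as in \<open>assouad_exponent\<close>, but \<open>S\<close> may leave \<open>A\<close>.\<close>

definition covered :: "'a::metric_space set \<Rightarrow> 'a set \<Rightarrow> real \<Rightarrow> real \<Rightarrow> bool" where
  "covered S A r k \<longleftrightarrow>
     (\<exists>F. finite F \<and> F \<subseteq> A \<and> real (card F) \<le> k \<and> S \<subseteq> (\<Union>y\<in>F. cball y r))"

lemma covered_mono:
  assumes "covered S A r k" "S' \<subseteq> S" "A \<subseteq> A'" "r \<le> r'" "k \<le> k'"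
  shows "covered S' A' r' k'"
proof -
  obtain F where F: "finite F" "F \<subseteq> A" "real (card F) \<le> k" "S \<subseteq> (\<Union>y\<in>F. cball y r)"
    using assms(1) unfolding covered_def by blast
  have "(\<Union>y\<in>F. cball y r) \<subseteq> (\<Union>y\<in>F. cball y r')"
    using assms(4) by force
  then show ?thesis
    unfolding covered_def using F(1,3) assms(5) subset_trans[OF F(2) assms(3)]
      subset_trans[OF subset_trans[OF assms(2) F(4)]]
    by (intro exI[of _ F] conjI) simp_all
qed

lemma covered_empty: "0 \<le> k \<Longrightarrow> covered {} A r k"
  unfolding covered_def by (intro exI[of _ "{}"]) auto

lemma covered_Un:
  assumes "covered S A r k" "covered T A r l"
  shows "covered (S \<union> T) A r (k + l)"
proof -
  obtain F where F: "finite F" "F \<subseteq> A" "real (card F) \<le> k" "S \<subseteq> (\<Union>y\<in>F. cball y r)"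
    using assms(1) unfolding covered_def by blast
  obtain G where G: "finite G" "G \<subseteq> A" "real (card G) \<le> l" "T \<subseteq> (\<Union>y\<in>G. cball y r)"
    using assms(2) unfolding covered_def by blast
  have "real (card (F \<union> G)) \<le> k + l"
    using card_Un_le[of F G] F G by linarith
  then show ?thesis
    unfolding covered_def using F G by (intro exI[of _ "F \<union> G"]) auto
qed

lemma covered_UN_sum:
  assumes "finite I" "\<And>i. i \<in> I \<Longrightarrow> covered (S i) A r (k i)"
  shows "covered (\<Union>i\<in>I. S i) A r (\<Sum>i\<in>I. k i)"
  using assms
proof (induction I rule: finite_induct)
  case empty
  then show ?case by (simp add: covered_empty)
next
  case (insert i I)
  then show ?case using covered_Un[of "S i" A r "k i"] by simp
qed

lemma covered_UN:
  assumes "finite I" "real (card I) \<le> m" "0 \<le> k" "\<And>i. i \<in> I \<Longrightarrow> covered (S i) A r k"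
  shows "covered (\<Union>i\<in>I. S i) A r (m * k)"
proof -
  have "covered (\<Union>i\<in>I. S i) A r (\<Sum>i\<in>I. k)"
    using assms by (intro covered_UN_sum) auto
  then show ?thesis
    using assms by (elim covered_mono) (auto intro: mult_right_mono)
qed

lemma covered_similitude_image:
  assumes "covered S A r k" "\<And>x y. dist (f x) (f y) = \<rho> * dist x y" "0 \<le> \<rho>"
  shows "covered (f ` S) (f ` A) (\<rho> * r) k"
proof -
  obtain F where F: "finite F" "F \<subseteq> A" "real (card F) \<le> k" "S \<subseteq> (\<Union>y\<in>F. cball y r)"
    using assms(1) unfolding covered_def by blast
  have "f ` S \<subseteq> (\<Union>y\<in>f ` F. cball y (\<rho> * r))"
  proof
    fix z assume "z \<in> f ` S"
    then obtain x y where "z = f x" "y \<in> F" "dist y x \<le> r" using F(4) by force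
    then show "z \<in> (\<Union>y\<in>f ` F. cball y (\<rho> * r))"
      using assms by (auto intro!: mult_left_mono)
  qed
  moreover have "real (card (f ` F)) \<le> k"
    using card_image_le[OF F(1), of f] F(3) by linarith
  ultimately show ?thesis
    unfolding covered_def using F by (intro exI[of _ "f ` F"]) auto
qed

text \<open>Balls that miss \<open>S\<close> are discarded, and each remaining one is replaced by a
  ball of twice the radius about a point of \<open>S\<close> in it. This moves the centres from
  \<open>B\<close> into \<open>A\<close>.\<close>

lemma covered_recentre:
  assumes "covered S B r k" "S \<subseteq> A"
  shows "covered S A (2 * r) k"
proof -
  obtain F where F: "finite F" "real (card F) \<le> k" "S \<subseteq> (\<Union>y\<in>F. cball y r)"
    using assms(1) unfolding covered_def by blast
  define G where "G = {y \<in> F. cball y r \<inter> S \<noteq> {}}"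
  define g where "g y = (SOME z. z \<in> cball y r \<inter> S)" for y
  have g: "g y \<in> cball y r \<inter> S" if "y \<in> G" for y
    using that someI_ex[of "\<lambda>z. z \<in> cball y r \<inter> S"] unfolding G_def g_def by blast
  have "S \<subseteq> (\<Union>y\<in>g ` G. cball y (2 * r))"
  proof
    fix z assume "z \<in> S"
    then obtain y where y: "y \<in> F" "z \<in> cball y r" using F by blast
    then have "y \<in> G" using \<open>z \<in> S\<close> G_def by blast
    moreover have "dist (g y) z \<le> 2 * r"
      using g[OF \<open>y \<in> G\<close>] y dist_triangle2[of "g y" z y] by (simp add: dist_commute)
    ultimately show "z \<in> (\<Union>y\<in>g ` G. cball y (2 * r))" by auto
  qed
  moreover have "card (g ` G) \<le> card F"
  proof -
    have "G \<subseteq> F" by (auto simp: G_def)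
    then show ?thesis
      using F(1) card_image_le[of G g] card_mono[of F G] finite_subset[of G F] by linarith
  qed
  moreover have "finite (g ` G)" "g ` G \<subseteq> A"
    using F(1) g assms(2) by (auto simp: G_def)
  moreover have "real (card (g ` G)) \<le> k"
    using F(2) \<open>card (g ` G) \<le> card F\<close> by linarith
  ultimately show ?thesis
    unfolding covered_def by (intro exI[of _ "g ` G"] conjI)
qed

section \<open>Uniform covering exponents of compact sets\<close>

text \<open>For compact sets and \<open>s \<ge> 0\<close> this is equivalent to \<open>assouad_exponent\<close>, but the centres of the
  large balls are arbitrary and there is no upper bound on \<open>R\<close>.\<close>

definition uniform_exponent :: "'a::metric_space set \<Rightarrow> real \<Rightarrow> bool" where
  "uniform_exponent A s \<longleftrightarrow>
     (\<exists>c\<ge>1. \<forall>x r R. 0 < r \<and> r \<le> R \<longrightarrow> covered (cball x R \<inter> A) A r (c * (R / r) powr s))"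

lemma uniform_exponent_mono:
  assumes "uniform_exponent A s" "s \<le> t"
  shows "uniform_exponent A t"
proof -
  obtain c where c: "c \<ge> 1"
    and cov: "\<And>x r R. 0 < r \<Longrightarrow> r \<le> R \<Longrightarrow> covered (cball x R \<inter> A) A r (c * (R / r) powr s)"
    using assms(1) unfolding uniform_exponent_def by blast
  have "covered (cball x R \<inter> A) A r (c * (R / r) powr t)" if "0 < r" "r \<le> R" for x r R
    using c that assms(2) by (intro covered_mono[OF cov[OF that]] mult_left_mono powr_mono) auto
  then show ?thesis
    unfolding uniform_exponent_def using c by blast
qed

text \<open>Covering at radius \<open>r / 2\<close> with centres in \<open>B\<close> and recentring
  gives radius \<open>r\<close> with centres in \<open>A\<close>, at the price of a factor
  \<open>2 powr s\<close>.\<close>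

lemma uniform_exponent_subset:
  assumes "uniform_exponent B s" "A \<subseteq> B"
  shows "uniform_exponent A s"
proof -
  obtain c where c: "c \<ge> 1"
    and cov: "\<And>x r R. 0 < r \<Longrightarrow> r \<le> R \<Longrightarrow> covered (cball x R \<inter> B) B r (c * (R / r) powr s)"
    using assms(1) unfolding uniform_exponent_def by blast
  \<comment> \<open>\<open>max 1\<close> is there because a negative \<open>s\<close> may bring
    \<open>c * 2 powr s\<close> below 1.\<close>
  have "covered (cball x R \<inter> A) A r (max 1 (c * 2 powr s) * (R / r) powr s)"
    if "0 < r" "r \<le> R" for x r R
  proof -
    have "covered (cball x R \<inter> A) B (r / 2) (c * (R / (r / 2)) powr s)"
      using that assms(2) by (intro covered_mono[OF cov[of "r / 2" R]]) auto
    then have "covered (cball x R \<inter> A) A r (c * (R / (r / 2)) powr s)"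
      using covered_recentre[of "cball x R \<inter> A" B "r / 2" _ A] by simp
    moreover have "(R / (r / 2)) powr s = 2 powr s * (R / r) powr s"
      using that powr_mult[of 2 "R / r" s] by (simp add: mult.commute)
    ultimately show ?thesis
      by (elim covered_mono) (auto simp: mult.assoc[symmetric] intro!: mult_right_mono)
  qed
  then show ?thesis
    unfolding uniform_exponent_def by (intro exI[of _ "max 1 (c * 2 powr s)"]) auto
qed

lemma uniform_imp_assouad_exponent:
  assumes "uniform_exponent A s"
  shows "assouad_exponent A s"
proof -
  obtain c where c: "c \<ge> 1"
    and cov: "\<And>x r R. 0 < r \<Longrightarrow> r \<le> R \<Longrightarrow> covered (cball x R \<inter> A) A r (c * (R / r) powr s)"
    using assms(1) unfolding uniform_exponent_def by blast
  have "\<exists>F. finite F \<and> F \<subseteq> A \<and> real (card F) \<le> c * (r / R) powr (- s) \<and>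
             cball x R \<inter> A \<subseteq> (\<Union>y\<in>F. cball y r \<inter> A)"
    if "0 < r" "r < R" for x r R
  proof -
    have "(r / R) powr (- s) = (R / r) powr s"
      using that by (simp add: powr_minus_divide powr_divide)
    then have "covered (cball x R \<inter> A) A r (c * (r / R) powr (- s))"
      using cov[of r R x] that by simp
    then obtain F where F: "finite F" "F \<subseteq> A" "real (card F) \<le> c * (r / R) powr (- s)"
      "cball x R \<inter> A \<subseteq> (\<Union>y\<in>F. cball y r)"
      unfolding covered_def by blast
    then show ?thesis by (intro exI[of _ F]) auto
  qed
  then show ?thesis
    unfolding assouad_exponent_def using c by (intro exI[of _ c]) auto
qed

text \<open>Radii of at least half the diameter are handled by a finite net, and a ball about an
  arbitrary point that meets \<open>A\<close> lies in a ball of twice the radius about a point of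
  \<open>A\<close>.\<close>

lemma assouad_imp_uniform_exponent:
  assumes "compact A" "assouad_exponent A s" "0 \<le> s"
  shows "uniform_exponent A s"
proof (cases "A = {} \<or> is_singleton A")
  \<comment> \<open>With at most one point, \<open>A\<close> itself serves as the set of centres;
    the other case relies on a positive diameter.\<close>
  case True
  then have A: "finite A" "card A \<le> 1" by (auto simp: is_singleton_def)
  have "covered (cball x R \<inter> A) A r (1 * (R / r) powr s)" if "0 < r" "r \<le> R" for x r R
  proof -
    have "1 \<le> (R / r) powr s" using that assms(3) by (intro ge_one_powr_ge_zero) auto
    then show ?thesis
      unfolding covered_def using A that by (intro exI[of _ A]) auto
  qed
  then show ?thesis unfolding uniform_exponent_def by (intro exI[of _ 1]) auto
next
  case False
  define d where "d = diameter A"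
  have bA: "bounded A" using assms(1) by (rule compact_imp_bounded)
  obtain a b where ab: "a \<in> A" "b \<in> A" "a \<noteq> b"
    using False is_singletonI'[of A] by blast
  then have d: "d > 0"
    using diameter_bounded_bound[OF bA, of a b] zero_less_dist_iff[of a b] unfolding d_def by linarith
  obtain c where c: "c \<ge> 1"
    and "\<forall>x\<in>A. \<forall>r R. 0 < r \<and> r < R \<and> (bounded A \<and> \<not> is_singleton A \<longrightarrow> R < diameter A) \<longrightarrow>
        (\<exists>F. finite F \<and> F \<subseteq> A \<and> real (card F) \<le> c * (r / R) powr (- s) \<and>
             cball x R \<inter> A \<subseteq> (\<Union>y\<in>F. cball y r \<inter> A))"
    using assms(2) unfolding assouad_exponent_def by blast
  then have ass: "\<exists>F. finite F \<and> F \<subseteq> A \<and> real (card F) \<le> c * (r / R) powr (- s) \<and>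
             cball x R \<inter> A \<subseteq> (\<Union>y\<in>F. cball y r \<inter> A)"
    if "x \<in> A" "0 < r" "r < R" "R < d" for x r R
    using that unfolding d_def by blast
  have small: "covered (cball x R \<inter> A) A r (c * (R / r) powr s)"
    if "x \<in> A" "0 < r" "r < R" "R < d" for x r R
  proof -
    have "(r / R) powr (- s) = (R / r) powr s"
      using that by (simp add: powr_minus_divide powr_divide)
    then have "\<exists>F. finite F \<and> F \<subseteq> A \<and> real (card F) \<le> c * (R / r) powr s \<and>
             cball x R \<inter> A \<subseteq> (\<Union>y\<in>F. cball y r \<inter> A)"
      using ass[OF that] by (simp only:)
    then obtain F where "finite F" "F \<subseteq> A" "real (card F) \<le> c * (R / r) powr s"
      "cball x R \<inter> A \<subseteq> (\<Union>y\<in>F. cball y r \<inter> A)"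
      by blast
    then show ?thesis unfolding covered_def by (intro exI[of _ F]) auto
  qed
  \<comment> \<open>The net has mesh \<open>d / 2\<close> because \<open>small\<close> requires
    \<open>R < d\<close>.\<close>
  obtain T where T: "finite T" "T \<subseteq> A" "A \<subseteq> (\<Union>t\<in>T. ball t (d / 2))"
    using seq_compact_imp_totally_bounded[OF compact_imp_seq_compact[OF assms(1)], rule_format,
        of "d / 2"] d by auto
  have "T \<noteq> {}" using T ab by auto
  then have T1: "1 \<le> real (card T)"
    using T(1) by (metis One_nat_def Suc_leI card_gt_0_iff of_nat_1 of_nat_le_iff)
  have AT: "A \<subseteq> (\<Union>t\<in>T. cball t (d / 2))"
    using T(3) by (meson SUP_mono ball_subset_cball subset_trans)
  \<comment> \<open>Below \<open>d / 2\<close> the piece around each net point is covered by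
    \<open>small\<close>; from \<open>d / 2\<close> on the net itself is a covering.\<close>
  have all: "covered A A r (real (card T) * (c * (R / r) powr s))"
    if "0 < r" "r \<le> R" "R \<ge> d / 2" for r R
  proof (cases "r < d / 2")
    case True
    have "covered (cball t (d / 2) \<inter> A) A r (c * (R / r) powr s)" if "t \<in> T" for t
    proof (rule covered_mono[OF small[of t r "d / 2"]])
      show "c * (d / 2 / r) powr s \<le> c * (R / r) powr s"
        using \<open>0 < r\<close> \<open>R \<ge> d / 2\<close> d c assms(3)
        by (intro mult_left_mono powr_mono2 divide_right_mono) auto
    qed (use T d True that \<open>0 < r\<close> in auto)
    then have "covered (\<Union>t\<in>T. cball t (d / 2) \<inter> A) A r (real (card T) * (c * (R / r) powr s))"
      using T(1) c by (intro covered_UN) auto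
    then show ?thesis
      using AT by (elim covered_mono) auto
  next
    case False
    have "1 * 1 \<le> c * (R / r) powr s"
      using that assms(3) c by (intro mult_mono ge_one_powr_ge_zero) auto
    then have "covered A A (d / 2) (real (card T) * (c * (R / r) powr s))"
      unfolding covered_def using T AT T1 by (intro exI[of _ T]) auto
    then show ?thesis using False by (elim covered_mono) auto
  qed
  have centred: "covered (cball x R \<inter> A) A r (real (card T) * (c * (R / r) powr s))"
    if "x \<in> A" "0 < r" "r \<le> R" for x r R
  proof -
    have large: "1 * (c * (R / r) powr s) \<le> real (card T) * (c * (R / r) powr s)"
      using T1 c by (intro mult_right_mono) auto
    \<comment> \<open>The case \<open>r = R\<close> stands apart because \<open>small\<close> needs
      \<open>r < R\<close>; there the single ball about \<open>x\<close> suffices.\<close>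
    consider "R \<ge> d / 2" | "r < R" "R < d / 2" | "r = R"
      using \<open>r \<le> R\<close> by linarith
    then show ?thesis
    proof cases
      case 1
      then show ?thesis using that by (intro covered_mono[OF all[of r R]]) auto
    next
      case 2
      then show ?thesis using that d large by (intro covered_mono[OF small[of x r R]]) auto
    next
      case 3
      then have "(R / r) powr s = 1" using \<open>0 < r\<close> by simp
      then have "1 \<le> real (card T) * (c * (R / r) powr s)"
        using large c by (metis mult_1 mult.right_neutral order_trans)
      then show ?thesis
        unfolding covered_def using that 3 by (intro exI[of _ "{x}"]) auto
    qed
  qed
  have "covered (cball x R \<inter> A) A r ((real (card T) * c * 2 powr s) * (R / r) powr s)"
    if "0 < r" "r \<le> R" for x r R
  proof (cases "cball x R \<inter> A = {}")
    case True
    then show ?thesis using c by (simp add: covered_empty)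
  next
    case False
    then obtain z where z: "z \<in> A" "dist x z \<le> R" by auto
    have "cball x R \<subseteq> cball z (2 * R)"
      using z by (auto simp: cball_subset_cball_iff) (smt (verit) dist_triangle2 dist_commute)
    then have "covered (cball x R \<inter> A) A r (real (card T) * (c * (2 * R / r) powr s))"
      using z that by (intro covered_mono[OF centred[of z r "2 * R"]]) auto
    moreover have "(2 * R / r) powr s = 2 powr s * (R / r) powr s"
      using that powr_mult[of 2 "R / r" s] by simp
    ultimately show ?thesis by (simp add: mult.assoc)
  qed
  moreover have "1 \<le> real (card T) * c * 2 powr s"
  proof -
    have "1 * 1 * 1 \<le> real (card T) * c * 2 powr s"
      using T1 c assms(3) by (intro mult_mono ge_one_powr_ge_zero) auto
    then show ?thesis by simp
  qed
  ultimately show ?thesis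
    unfolding uniform_exponent_def by blast
qed

section \<open>Assouad dimension through uniform exponents\<close>

text \<open>\<open>assouad_exponent\<close> ties the centres and the range of \<open>R\<close> to
  the set itself, so an exponent of \<open>B\<close> is passed to \<open>A\<close> through
  \<open>uniform_exponent\<close>, which subsets inherit.\<close>

lemma assouad_dim_mono:
  assumes "compact B" "A \<subseteq> B"
  shows "assouad_dim A \<le> assouad_dim B"
proof -
  have "{s. 0 \<le> s \<and> assouad_exponent B s} \<subseteq> {s. 0 \<le> s \<and> assouad_exponent A s}"
  proof (intro subsetI CollectI conjI; elim CollectE conjE)
    fix s assume "0 \<le> s" "assouad_exponent B s"
    then have "uniform_exponent B s"
      by (intro assouad_imp_uniform_exponent[OF assms(1)])
    then show "assouad_exponent A s"
      by (intro uniform_imp_assouad_exponent uniform_exponent_subset[OF _ assms(2)])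
  qed
  then show ?thesis
    unfolding assouad_dim_def by (intro Inf_superset_mono image_mono)
qed

lemma uniform_exponent_if_assouad_dim_less:
  assumes "compact A" "assouad_dim A < ereal t"
  shows "uniform_exponent A t" "0 \<le> t"
proof -
  obtain s where s: "0 \<le> s" "assouad_exponent A s" "s < t"
    using assms(2) unfolding assouad_dim_def Inf_less_iff by auto
  then show "0 \<le> t" by simp
  show "uniform_exponent A t"
    using uniform_exponent_mono[OF assouad_imp_uniform_exponent[OF assms(1) s(2,1)]] s(3) by simp
qed

lemma assouad_dim_le:
  assumes "uniform_exponent A t" "0 \<le> t"
  shows "assouad_dim A \<le> ereal t"
  unfolding assouad_dim_def using assms uniform_imp_assouad_exponent by (intro Inf_lower) auto

section \<open>Packing and similitudes in Euclidean space\<close>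

text \<open>Pigeonhole after rescaling to the unit ball: finitely many balls of radius
  \<open>\<eta> / 2\<close> cover it, and each holds at most one rescaled point. The bound is thus
  independent of \<open>x\<close> and \<open>R\<close>. The points are indexed so that words can be
  counted.\<close>

lemma card_separated_bound:
  fixes \<eta> :: real
  assumes "\<eta> > 0"
  shows "\<exists>M. \<forall>(x :: 'a::euclidean_space) R (I :: 'b set) p. R > 0 \<longrightarrow> p ` I \<subseteq> cball x R \<longrightarrow>
       (\<forall>i\<in>I. \<forall>j\<in>I. i \<noteq> j \<longrightarrow> \<eta> * R \<le> dist (p i) (p j)) \<longrightarrow> finite I \<and> card I \<le> M"
proof -
  obtain T where T: "finite T" "cball (0::'a) 1 \<subseteq> (\<Union>t\<in>T. ball t (\<eta> / 2))"
    using compact_eq_totally_bounded[THEN iffD1, OF compact_cball, THEN conjunct2, rule_format,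
        of "\<eta> / 2" 0 1] assms by auto
  show ?thesis
  proof (intro exI[of _ "card T"] allI impI)
    fix x :: 'a and R :: real and I :: "'b set" and p
    assume R: "0 < R" and p: "p ` I \<subseteq> cball x R"
      and sep: "\<forall>i\<in>I. \<forall>j\<in>I. i \<noteq> j \<longrightarrow> \<eta> * R \<le> dist (p i) (p j)"
    have "\<exists>t\<in>T. (p i - x) /\<^sub>R R \<in> ball t (\<eta> / 2)" if "i \<in> I" for i
    proof -
      have "(p i - x) /\<^sub>R R \<in> cball 0 1"
        using p that R by (simp add: image_subset_iff dist_norm norm_minus_commute divide_simps)
      then show ?thesis using T by blast
    qed
    then obtain t where t: "\<And>i. i \<in> I \<Longrightarrow> t i \<in> T"
      "\<And>i. i \<in> I \<Longrightarrow> dist (t i) ((p i - x) /\<^sub>R R) < \<eta> / 2"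
      by (metis mem_ball)
    have "inj_on t I"
    proof (rule inj_onI, rule ccontr)
      fix i j assume ij: "i \<in> I" "j \<in> I" "t i = t j" "i \<noteq> j"
      have "dist ((p i - x) /\<^sub>R R) ((p j - x) /\<^sub>R R) < \<eta>"
        using t(2)[OF ij(1)] t(2)[OF ij(2)] ij(3)
          dist_triangle3[of "(p i - x) /\<^sub>R R" "(p j - x) /\<^sub>R R" "t i"]
        by simp
      moreover have "(p i - x) /\<^sub>R R - (p j - x) /\<^sub>R R = (p i - p j) /\<^sub>R R"
        by (simp flip: scaleR_diff_right)
      ultimately have "norm (p i - p j) / R < \<eta>"
        using R unfolding dist_norm by (simp add: divide_inverse_commute)
      then have "dist (p i) (p j) < \<eta> * R"
        using R by (simp add: dist_norm pos_divide_less_eq)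
      then show False using sep ij by force
    qed
    then show "finite I \<and> card I \<le> card T"
      using t(1) T(1) by (meson card_inj_on_le image_subsetI inj_on_finite)
  qed
qed

text \<open>Similitudes of Euclidean space are onto: translated and divided by the ratio,
  \<open>f\<close> becomes an isometry \<open>g\<close> fixing 0, hence an orthogonal map, which is
  surjective.\<close>

lemma ball_similitude_image:
  fixes f :: "'a::euclidean_space \<Rightarrow> 'a"
  assumes "0 < \<rho>" and f: "\<And>x y. dist (f x) (f y) = \<rho> * dist x y"
  shows "ball (f x) (\<rho> * e) \<subseteq> f ` ball x e"
proof -
  define g where "g x = (f x - f 0) /\<^sub>R \<rho>" for x
  have "dist (g x) (g y) = dist x y" for x y
  proof -
    have "g x - g y = (f x - f y) /\<^sub>R \<rho>"
      unfolding g_def scaleR_right_diff_distrib by (rule diff_diff_eq2[THEN trans]) simp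
    then have "dist (g x) (g y) = dist (f x) (f y) / \<rho>"
      using assms(1) unfolding dist_norm by (simp add: divide_inverse_commute)
    then show ?thesis using f[of x y] assms(1) by simp
  qed
  moreover have "g 0 = 0" by (simp add: g_def)
  ultimately have "orthogonal_transformation g"
    unfolding orthogonal_transformation_isometry by blast
  then have "surj g" by (rule orthogonal_transformation_surj)
  show ?thesis
  proof
    fix z assume z: "z \<in> ball (f x) (\<rho> * e)"
    obtain y where "g y = (z - f 0) /\<^sub>R \<rho>" using \<open>surj g\<close> by (metis surjD)
    then have "z = f y" using assms(1) by (simp add: g_def)
    then show "z \<in> f ` ball x e" using z f assms(1) by auto
  qed
qed

section \<open>Words over an iterated function system\<close>

primrec word_map :: "(nat \<Rightarrow> 'a \<Rightarrow> 'a) \<Rightarrow> nat list \<Rightarrow> 'a \<Rightarrow> 'a" where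
  "word_map \<phi> [] = id"
| "word_map \<phi> (i # w) = \<phi> i \<circ> word_map \<phi> w"

lemma word_map_append: "word_map \<phi> (u @ v) = word_map \<phi> u \<circ> word_map \<phi> v"
  by (induction u) (auto simp: o_assoc)

text \<open>The ratios, which \<open>contractive_similitude\<close> only quantifies existentially,
  are fixed as a function \<open>\<rho>\<close> so that products along words can be formed.\<close>

locale similitudes =
  fixes \<kappa> :: nat and \<phi> :: "nat \<Rightarrow> 'a::metric_space \<Rightarrow> 'a" and \<rho> :: "nat \<Rightarrow> real"
  assumes rho: "\<And>i. i \<in> {1..\<kappa>} \<Longrightarrow> 0 < \<rho> i \<and> \<rho> i < 1"
    and dist_phi: "\<And>i x y. i \<in> {1..\<kappa>} \<Longrightarrow> dist (\<phi> i x) (\<phi> i y) = \<rho> i * dist x y"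
begin

abbreviation words :: "nat list set" where
  "words \<equiv> {w. set w \<subseteq> {1..\<kappa>}}"

abbreviation ratio :: "nat list \<Rightarrow> real" where
  "ratio w \<equiv> prod_list (map \<rho> w)"

abbreviation map_of_word :: "nat list \<Rightarrow> 'a \<Rightarrow> 'a" where
  "map_of_word \<equiv> word_map \<phi>"

lemma ratio_pos: "w \<in> words \<Longrightarrow> 0 < ratio w"
  by (induction w) (auto simp: rho)

text \<open>The ratio of a word is at most the power \<open>m ^ length w\<close> of the largest
  ratio \<open>m < 1\<close>, so one length serves all words.\<close>

lemma ratio_small:
  assumes "0 < \<epsilon>"
  shows "\<exists>n. \<forall>w\<in>words. length w = n \<longrightarrow> ratio w \<le> \<epsilon>"
proof -
  \<comment> \<open>Inserting 0 keeps the maximum meaningful for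
    \<open>\<kappa> = 0\<close>.\<close>
  define m where "m = Max (insert 0 (\<rho> ` {1..\<kappa>}))"
  have m: "0 \<le> m" "m < 1"
    using rho by (auto simp: m_def)
  have m_ge: "\<rho> i \<le> m" if "i \<in> {1..\<kappa>}" for i
    using that unfolding m_def by (intro Max_ge) auto
  obtain n where n: "m ^ n < \<epsilon>"
    using real_arch_pow_inv[OF assms m(2)] by blast
  have "ratio w \<le> m ^ length w" if "w \<in> words" for w
    using that
  proof (induction w)
    case (Cons i w)
    then show ?case
      using m m_ge[of i] rho[of i] ratio_pos[of w] by (auto intro!: mult_mono)
  qed simp
  then show ?thesis
    using n by (intro exI[of _ n]) force
qed

lemma dist_map_of_word:
  "w \<in> words \<Longrightarrow> dist (map_of_word w x) (map_of_word w y) = ratio w * dist x y"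
  by (induction w) (auto simp: dist_phi)

lemma map_of_word_invariant:
  assumes "\<And>i. i \<in> {1..\<kappa>} \<Longrightarrow> \<phi> i ` A \<subseteq> A" "w \<in> words"
  shows "map_of_word w ` A \<subseteq> A"
  using assms(2)
proof (induction w)
  case (Cons i w)
  then show ?case using assms(1)[of i] by (auto simp: image_subset_iff)
qed simp

text \<open>Unfolding the fixed-point equation \<open>n\<close> times, a point either survives to
  depth \<open>n\<close> or is caught on the way by a copy of \<open>C\<close>.\<close>

lemma inhomogeneous_cylinders:
  assumes "K = (\<Union>i\<in>{1..\<kappa>}. \<phi> i ` K) \<union> C" "x \<in> K"
  shows "(\<exists>w\<in>words. length w = n \<and> x \<in> map_of_word w ` K) \<or> (\<exists>w\<in>words. x \<in> map_of_word w ` C)"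
proof (induction n)
  case 0
  show ?case using assms(2) by (intro disjI1 bexI[of _ "[]"]) auto
next
  case (Suc n)
  then show ?case
  proof
    assume "\<exists>w\<in>words. length w = n \<and> x \<in> map_of_word w ` K"
    then obtain w y where w: "w \<in> words" "length w = n" and y: "x = map_of_word w y" "y \<in> K"
      by blast
    from y(2) have "y \<in> (\<Union>i\<in>{1..\<kappa>}. \<phi> i ` K) \<union> C" using assms(1) by simp
    then show ?case
    proof
      assume "y \<in> C"
      then show ?case using w y by blast
    next
      assume "y \<in> (\<Union>i\<in>{1..\<kappa>}. \<phi> i ` K)"
      then obtain i z where i: "i \<in> {1..\<kappa>}" "z \<in> K" "y = \<phi> i z" by blast
      \<comment> \<open>The new letter goes to the end of the word, since its map is applied
        first.\<close>
      then have "x = map_of_word (w @ [i]) z" using y by (simp add: word_map_append)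
      then show ?case
        using w i by (intro disjI1 bexI[of _ "w @ [i]"]) auto
    qed
  qed blast
qed

text \<open>A point of \<open>E\<close> lies in a tiny image of \<open>E\<close> under a long word,
  and the same word sends a fixed point \<open>a\<close> of \<open>A\<close> close by, still inside
  \<open>A\<close>. Closedness concludes.\<close>

lemma self_similar_set_subset:
  assumes E: "self_similar_set \<kappa> \<phi> E"
    and A: "closed A" "A \<noteq> {}" "\<And>i. i \<in> {1..\<kappa>} \<Longrightarrow> \<phi> i ` A \<subseteq> A"
  shows "E \<subseteq> A"
proof
  fix x assume "x \<in> E"
  \<comment> \<open>The union with the empty set brings the equation into the form of
    \<open>inhomogeneous_cylinders\<close> with empty condensation.\<close>
  have E': "E = (\<Union>i\<in>{1..\<kappa>}. \<phi> i ` E) \<union> {}" "bounded E"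
    using E compact_imp_bounded unfolding self_similar_set_def by auto
  obtain a where a: "a \<in> A" using A by blast
  obtain D0 where D0: "\<forall>y\<in>E. dist a y \<le> D0"
    using E'(2) bounded_any_center[of E a] by blast
  \<comment> \<open>The maximum with 1 makes \<open>D\<close> positive, so that one can divide by
    it.\<close>
  define D where "D = max 1 D0"
  have D: "\<And>y. y \<in> E \<Longrightarrow> dist a y \<le> D" "D > 0"
    using D0 by (auto simp: D_def intro: max.coboundedI2)
  have "\<exists>y\<in>A. dist y x < \<epsilon>" if \<epsilon>: "\<epsilon> > 0" for \<epsilon>
  proof -
    have "\<epsilon> / (2 * D) > 0" using \<epsilon> D by simp
    then obtain n where n: "\<forall>w\<in>words. length w = n \<longrightarrow> ratio w \<le> \<epsilon> / (2 * D)"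
      using ratio_small by blast
    obtain w y where w: "w \<in> words" "length w = n" "y \<in> E" "x = map_of_word w y"
      using inhomogeneous_cylinders[OF E'(1) \<open>x \<in> E\<close>, of n] by blast
    have "dist (map_of_word w a) x \<le> \<epsilon> / (2 * D) * D"
      unfolding w(4) dist_map_of_word[OF w(1)]
      using n[rule_format, OF w(1,2)] D(1)[OF w(3)] ratio_pos[OF w(1)] by (intro mult_mono) auto
    also have "\<dots> < \<epsilon>" using \<epsilon> D by simp
    finally show ?thesis
      using map_of_word_invariant[OF A(3) w(1)] a by blast
  qed
  then show "x \<in> A"
    using A(1) closed_approachable by blast
qed

end

section \<open>Separation of the copies of \<open>C\<close>\<close>

text \<open>A quantitative form of the condensation open set condition: one radius
  \<open>\<delta>\<close> works at every point of \<open>C\<close>.\<close>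

locale separated_condensation = similitudes \<kappa> \<phi> \<rho>
  for \<kappa> and \<phi> :: "nat \<Rightarrow> 'a::euclidean_space \<Rightarrow> 'a" and \<rho> +
  fixes C U :: "'a set" and \<delta> :: real
  assumes delta: "\<delta> > 0"
    and ball_C: "\<And>c. c \<in> C \<Longrightarrow> ball c \<delta> \<subseteq> U - (\<Union>i\<in>{1..\<kappa>}. \<phi> i ` U)"
    and U_invariant: "\<And>i. i \<in> {1..\<kappa>} \<Longrightarrow> \<phi> i ` U \<subseteq> U"
    and U_disjoint: "\<And>i j. i \<in> {1..\<kappa>} \<Longrightarrow> j \<in> {1..\<kappa>} \<Longrightarrow> i \<noteq> j \<Longrightarrow> \<phi> i ` U \<inter> \<phi> j ` U = {}"
begin

lemma map_of_word_in_U: "w \<in> words \<Longrightarrow> c \<in> C \<Longrightarrow> map_of_word w c \<in> U"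
  using map_of_word_invariant[OF U_invariant, of w] ball_C[of c] delta centre_in_ball[of c \<delta>] by blast

lemma ball_map_of_word:
  assumes "w \<in> words" "c \<in> C"
  shows "ball (map_of_word w c) (\<delta> * ratio w) \<subseteq> map_of_word w ` U"
proof -
  have "ball (map_of_word w c) (ratio w * \<delta>) \<subseteq> map_of_word w ` ball c \<delta>"
    using assms(1) by (intro ball_similitude_image ratio_pos dist_map_of_word)
  also have "\<dots> \<subseteq> map_of_word w ` U"
    using ball_C[OF assms(2)] by blast
  finally show ?thesis by (simp add: mult.commute)
qed

text \<open>After cancelling the common prefix either one word is empty, and the neighbourhood of \<open>C\<close>
  avoids every \<open>\<phi> i ` U\<close>, or the words start with different letters.\<close>

lemma map_of_word_separated:
  assumes "v \<in> words" "w \<in> words" "v \<noteq> w" "c \<in> C" "c' \<in> C"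
  shows "\<delta> * min (ratio v) (ratio w) \<le> dist (map_of_word v c) (map_of_word w c')"
  using assms(1-3)
proof (induction v arbitrary: w)
  case Nil
  then obtain j w' where w: "w = j # w'" by (cases w) auto
  then have "map_of_word w c' \<in> \<phi> j ` U" "j \<in> {1..\<kappa>}"
    using Nil map_of_word_in_U[of w' c'] assms(5) by auto
  then have "map_of_word w c' \<notin> ball c \<delta>"
    using ball_C[OF assms(4)] by blast
  moreover have "\<delta> * min 1 (ratio w) \<le> \<delta> * 1"
    using delta by (intro mult_left_mono) auto
  ultimately show ?case by simp
next
  case (Cons i v')
  then have i: "i \<in> {1..\<kappa>}" and v': "v' \<in> words" by auto
  show ?case
  proof (cases w)
    case Nil
    have "map_of_word (i # v') c \<in> \<phi> i ` U"
      using map_of_word_in_U[OF v' assms(4)] by auto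
    then have "map_of_word (i # v') c \<notin> ball c' \<delta>"
      using ball_C[OF assms(5)] i by blast
    moreover have "\<delta> * min (ratio (i # v')) 1 \<le> \<delta> * 1"
      using delta by (intro mult_left_mono) auto
    ultimately show ?thesis using Nil by (simp add: dist_commute)
  next
    case w: (Cons j w')
    then have j: "j \<in> {1..\<kappa>}" and w': "w' \<in> words" using Cons.prems by auto
    show ?thesis
    proof (cases "i = j")
      case True
      then have "\<delta> * min (ratio v') (ratio w') \<le> dist (map_of_word v' c) (map_of_word w' c')"
        using Cons w w' v' by auto
      then have "\<rho> i * (\<delta> * min (ratio v') (ratio w'))
        \<le> \<rho> i * dist (map_of_word v' c) (map_of_word w' c')"
        using rho[OF i] by (intro mult_left_mono) auto
      moreover have "\<rho> i * min (ratio v') (ratio w') = min (\<rho> i * ratio v') (\<rho> i * ratio w')"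
        using rho[OF i] by (simp add: min_mult_distrib_left)
      ultimately show ?thesis
        using w True dist_phi[OF i] by (simp add: mult.left_commute)
    next
      case False
      \<comment> \<open>The ball about the first point stays in the image of \<open>U\<close> under
        \<open>\<phi> i\<close>, whereas the second point lies in the disjoint image under
        \<open>\<phi> j\<close>.\<close>
      have "map_of_word w c' \<in> \<phi> j ` U"
        using map_of_word_in_U[OF w' assms(5)] w by auto
      moreover have "ball (map_of_word (i # v') c) (\<delta> * ratio (i # v')) \<subseteq> \<phi> i ` U"
      proof -
        have "map_of_word (i # v') ` U \<subseteq> \<phi> i ` U"
          using map_of_word_invariant[OF U_invariant v'] by (auto simp: image_subset_iff)
        then show ?thesis
          using ball_map_of_word[OF Cons.prems(1) assms(4)] by blast
      qed
      ultimately have "map_of_word w c' \<notin> ball (map_of_word (i # v') c) (\<delta> * ratio (i # v'))"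
        using U_disjoint[OF i j False] by blast
      moreover have "\<delta> * min (ratio (i # v')) (ratio w) \<le> \<delta> * ratio (i # v')"
        using delta by (intro mult_left_mono) auto
      ultimately show ?thesis by (simp only: mem_ball)
    qed
  qed
qed

definition hitting_words :: "'a \<Rightarrow> real \<Rightarrow> nat list set" where
  "hitting_words x R = {w \<in> words. map_of_word w ` C \<inter> cball x R \<noteq> {}}"

text \<open>One point of each copy is chosen in the ball. As both ratios exceed \<open>R\<close>,
  these points are at least \<open>\<delta> * R\<close> apart, and the packing bound
  applies.\<close>

lemma card_large_hitting_words:
  "\<exists>M. \<forall>x R. 0 < R \<longrightarrow> finite {w \<in> hitting_words x R. R < ratio w} \<and>
       card {w \<in> hitting_words x R. R < ratio w} \<le> M"
proof -
  obtain M where M: "\<forall>(x :: 'a) R (I :: nat list set) p. R > 0 \<longrightarrow> p ` I \<subseteq> cball x R \<longrightarrow>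
       (\<forall>i\<in>I. \<forall>j\<in>I. i \<noteq> j \<longrightarrow> \<delta> * R \<le> dist (p i) (p j)) \<longrightarrow> finite I \<and> card I \<le> M"
    using card_separated_bound[OF delta] by blast
  show ?thesis
  proof (intro exI[of _ M] allI impI)
    fix x :: 'a and R :: real assume R: "0 < R"
    define I where "I = {w \<in> hitting_words x R. R < ratio w}"
    have "\<forall>w\<in>I. \<exists>c\<in>C. map_of_word w c \<in> cball x R"
      by (auto simp: I_def hitting_words_def)
    then obtain c where c: "\<And>w. w \<in> I \<Longrightarrow> c w \<in> C" "\<And>w. w \<in> I \<Longrightarrow> map_of_word w (c w) \<in> cball x R"
      by metis
    have "\<delta> * R \<le> dist (map_of_word v (c v)) (map_of_word w (c w))"
      if "v \<in> I" "w \<in> I" "v \<noteq> w" for v w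
    proof -
      have "\<delta> * R \<le> \<delta> * min (ratio v) (ratio w)"
        using that delta by (intro mult_left_mono) (auto simp: I_def)
      also have "\<dots> \<le> dist (map_of_word v (c v)) (map_of_word w (c w))"
        using that c by (intro map_of_word_separated) (auto simp: I_def hitting_words_def)
      finally show ?thesis .
    qed
    then show "finite {w \<in> hitting_words x R. R < ratio w} \<and>
       card {w \<in> hitting_words x R. R < ratio w} \<le> M"
      unfolding I_def[symmetric]
      using M[rule_format, OF R, of "\<lambda>w. map_of_word w (c w)" I x] c(2) by blast
  qed
qed

end

section \<open>The self-similar set inside the inhomogeneous one\<close>

text \<open>A point of \<open>C\<close> will serve as the centre of a ball containing all of
  \<open>C\<close>; empty condensation is treated separately in the theorem.\<close>

locale condensation_sets = separated_condensation \<kappa> \<phi> \<rho> C U \<delta>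
  for \<kappa> and \<phi> :: "nat \<Rightarrow> 'a::euclidean_space \<Rightarrow> 'a" and \<rho> C U \<delta> +
  fixes E K :: "'a set"
  assumes self_similar: "self_similar_set \<kappa> \<phi> E"
    and inhomogeneous: "inhomogeneous_self_similar_set \<kappa> \<phi> C K"
    and C_nonempty: "C \<noteq> {}"
begin

lemma K_eq: "K = (\<Union>i\<in>{1..\<kappa>}. \<phi> i ` K) \<union> C"
  using inhomogeneous unfolding inhomogeneous_self_similar_set_def by blast

lemma compact_K: "compact K"
  using inhomogeneous unfolding inhomogeneous_self_similar_set_def by blast

lemma map_of_word_K: "w \<in> words \<Longrightarrow> map_of_word w ` K \<subseteq> K"
  by (rule map_of_word_invariant) (use K_eq in blast)

lemma map_of_word_E: "w \<in> words \<Longrightarrow> map_of_word w ` E \<subseteq> E"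
proof (rule map_of_word_invariant)
  have "E = (\<Union>i\<in>{1..\<kappa>}. \<phi> i ` E)"
    using self_similar unfolding self_similar_set_def by blast
  then show "\<phi> i ` E \<subseteq> E" if "i \<in> {1..\<kappa>}" for i
    using that by blast
qed

lemma C_subset_K: "C \<subseteq> K"
  using K_eq by blast

lemma E_subset_K: "E \<subseteq> K"
  using self_similar
proof (rule self_similar_set_subset)
  show "K \<noteq> {}" using C_nonempty C_subset_K by blast
  show "\<phi> i ` K \<subseteq> K" if "i \<in> {1..\<kappa>}" for i using that K_eq by blast
qed (rule compact_imp_closed[OF compact_K])

definition D :: real where
  "D = max 1 (diameter K)"

lemma D_ge_1: "1 \<le> D"
  by (simp add: D_def)

lemma dist_K: "x \<in> K \<Longrightarrow> y \<in> K \<Longrightarrow> dist x y \<le> D"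
  using diameter_bounded_bound[OF compact_imp_bounded[OF compact_K], of x y] by (simp add: D_def)

lemma dist_map_of_word_le:
  assumes "w \<in> words" "x \<in> K" "y \<in> K"
  shows "dist (map_of_word w x) (map_of_word w y) \<le> D * ratio w"
  using dist_map_of_word[OF assms(1)] dist_K[OF assms(2,3)] ratio_pos[OF assms(1)]
  by (simp add: mult.commute)

lemma E_nonempty: "\<exists>e. e \<in> E"
  using self_similar unfolding self_similar_set_def by blast

text \<open>If \<open>z\<close> lies in the image of \<open>K\<close> under a word of ratio at most
  \<open>s\<close>, then the image of a point of \<open>E\<close> under that word is in
  \<open>E\<close> and within \<open>D * s\<close> of \<open>z\<close>. Otherwise \<open>z\<close>
  was caught by a copy of \<open>C\<close> of larger ratio.\<close>

lemma near_E_or_large_word: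
  assumes "0 < s" "z \<in> K"
  shows "(\<exists>e\<in>E. dist z e \<le> D * s) \<or> (\<exists>w\<in>words. s < ratio w \<and> z \<in> map_of_word w ` C)"
proof -
  obtain e where e: "e \<in> E" using E_nonempty by blast
  have near: "\<exists>e\<in>E. dist z e \<le> D * s"
    if w: "w \<in> words" "ratio w \<le> s" "z \<in> map_of_word w ` K" for w
  proof -
    obtain y where y: "y \<in> K" "z = map_of_word w y" using w(3) by blast
    have "dist z (map_of_word w e) \<le> D * ratio w"
      using dist_map_of_word_le[OF w(1) y(1), of e] e E_subset_K y(2) by auto
    also have "\<dots> \<le> D * s" using w(2) D_ge_1 by (intro mult_left_mono) auto
    finally show ?thesis using map_of_word_E[OF w(1)] e by blast
  qed
  obtain n where n: "\<forall>w\<in>words. length w = n \<longrightarrow> ratio w \<le> s"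
    using ratio_small[OF assms(1)] by blast
  from inhomogeneous_cylinders[OF K_eq assms(2), of n] show ?thesis
  proof
    assume "\<exists>w\<in>words. length w = n \<and> z \<in> map_of_word w ` K"
    then show ?thesis using near n by blast
  next
    assume "\<exists>w\<in>words. z \<in> map_of_word w ` C"
    then obtain w where w: "w \<in> words" "z \<in> map_of_word w ` C" by blast
    then have "z \<in> map_of_word w ` K" using C_subset_K by blast
    then show ?thesis
      using near[of w] w by (cases "ratio w \<le> s") auto
  qed
qed

section \<open>Counting the copies of \<open>C\<close> of a given size\<close>

text \<open>The orbit of a point of \<open>E\<close> places each of these words near some centre of a covering of \<open>E\<close>
  at scale \<open>q\<close>, and by separation only boundedly many words share a centre.\<close>

lemma card_hitting_words:
  assumes "uniform_exponent E t"
  shows "\<exists>M\<ge>0. \<forall>x R q. 0 < q \<and> q \<le> R \<longrightarrow>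
    finite {w \<in> hitting_words x R. q / 2 < ratio w \<and> ratio w \<le> q} \<and>
    real (card {w \<in> hitting_words x R. q / 2 < ratio w \<and> ratio w \<le> q}) \<le> M * (R / q) powr t"
proof -
  obtain c where c: "c \<ge> 1"
    and cov: "\<And>x r R. 0 < r \<Longrightarrow> r \<le> R \<Longrightarrow> covered (cball x R \<inter> E) E r (c * (R / r) powr t)"
    using assms unfolding uniform_exponent_def by blast
  \<comment> \<open>The packing bound will be used for points in a ball of radius
    \<open>(1 + D) * q\<close> with mutual distances at least \<open>\<delta> * q / 2\<close>,
    whence this quotient.\<close>
  have "\<delta> / (2 * (1 + D)) > 0" using delta D_ge_1 by simp
  from card_separated_bound[OF this, where 'a = 'a and 'b = "nat list"]
  obtain M where M: "\<forall>(x :: 'a) R (I :: nat list set) p. R > 0 \<longrightarrow> p ` I \<subseteq> cball x R \<longrightarrow>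
       (\<forall>i\<in>I. \<forall>j\<in>I. i \<noteq> j \<longrightarrow> \<delta> / (2 * (1 + D)) * R \<le> dist (p i) (p j)) \<longrightarrow> finite I \<and> card I \<le> M"
    by (elim exE)
  obtain e where e: "e \<in> E" "e \<in> K" using E_nonempty E_subset_K by blast
  have "finite {w \<in> hitting_words x R. q / 2 < ratio w \<and> ratio w \<le> q} \<and>
    real (card {w \<in> hitting_words x R. q / 2 < ratio w \<and> ratio w \<le> q})
      \<le> (c * (1 + D) powr t * real M) * (R / q) powr t"
    if q: "0 < q" "q \<le> R" for x R q
  proof -
    define I where "I = {w \<in> hitting_words x R. q / 2 < ratio w \<and> ratio w \<le> q}"
    have I: "w \<in> words" "q / 2 < ratio w" "ratio w \<le> q" if "w \<in> I" for w
      using that by (auto simp: I_def hitting_words_def)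
    have "\<forall>w\<in>I. \<exists>p\<in>C. map_of_word w p \<in> cball x R"
      by (auto simp: I_def hitting_words_def)
    then obtain p where p: "\<And>w. w \<in> I \<Longrightarrow> p w \<in> C" "\<And>w. w \<in> I \<Longrightarrow> map_of_word w (p w) \<in> cball x R"
      by metis
    have pe: "dist (map_of_word w (p w)) (map_of_word w e) \<le> D * q" if "w \<in> I" for w
    proof -
      have "dist (map_of_word w (p w)) (map_of_word w e) \<le> D * ratio w"
        using p(1)[OF that] C_subset_K e(2) I(1)[OF that] by (intro dist_map_of_word_le) auto
      also have "\<dots> \<le> D * q" using I(3)[OF that] D_ge_1 by (intro mult_left_mono) auto
      finally show ?thesis .
    qed
    \<comment> \<open>The image of \<open>e\<close> is within \<open>D * q\<close>, hence within
      \<open>D * R\<close>, of a point of the ball, so the radius \<open>(1 + D) * R\<close>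
      captures it.\<close>
    have "R \<le> (1 + D) * R" using q D_ge_1 by simp
    then have "covered (cball x ((1 + D) * R) \<inter> E) E q (c * ((1 + D) * R / q) powr t)"
      using q by (intro cov) linarith+
    moreover have "((1 + D) * R / q) powr t = (1 + D) powr t * (R / q) powr t"
      using powr_mult[of "1 + D" "R / q" t] q D_ge_1 by simp
    ultimately obtain F where F: "finite F" "real (card F) \<le> c * ((1 + D) powr t * (R / q) powr t)"
      "cball x ((1 + D) * R) \<inter> E \<subseteq> (\<Union>y\<in>F. cball y q)"
      unfolding covered_def by auto
    \<comment> \<open>Words are grouped by the centre near which they send \<open>e\<close>; their
      chosen points then lie within \<open>(1 + D) * q\<close> of that centre.\<close>
    define J where "J y = {w \<in> I. map_of_word w e \<in> cball y q}" for y
    have J: "finite (J y) \<and> card (J y) \<le> M" for y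
    proof (rule M[rule_format])
      show "0 < (1 + D) * q" using q D_ge_1 by simp
      show "(\<lambda>w. map_of_word w (p w)) ` J y \<subseteq> cball y ((1 + D) * q)"
      proof (rule image_subsetI)
        fix w assume w: "w \<in> J y"
        then have "dist y (map_of_word w e) \<le> q" by (simp add: J_def)
        then show "map_of_word w (p w) \<in> cball y ((1 + D) * q)"
          using pe[of w] w dist_triangle2[of y "map_of_word w (p w)" "map_of_word w e"]
          by (simp add: J_def algebra_simps)
      qed
      fix v w assume vw: "v \<in> J y" "w \<in> J y" "v \<noteq> w"
      then have vwI: "v \<in> I" "w \<in> I" by (auto simp: J_def)
      have "\<delta> / (2 * (1 + D)) * ((1 + D) * q) = \<delta> * (q / 2)"
        using D_ge_1 by (simp add: field_simps)
      also have "\<dots> \<le> \<delta> * min (ratio v) (ratio w)"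
        using delta I(2)[OF vwI(1)] I(2)[OF vwI(2)] by (intro mult_left_mono) auto
      also have "\<dots> \<le> dist (map_of_word v (p v)) (map_of_word w (p w))"
        using vwI vw(3) p(1) I(1) by (intro map_of_word_separated) auto
      finally show "\<delta> / (2 * (1 + D)) * ((1 + D) * q)
          \<le> dist (map_of_word v (p v)) (map_of_word w (p w))" .
    qed
    have IJ: "I \<subseteq> (\<Union>y\<in>F. J y)"
    proof
      fix w assume w: "w \<in> I"
      have "D * q \<le> D * R" using q D_ge_1 by (intro mult_left_mono) auto
      then have "dist x (map_of_word w e) \<le> (1 + D) * R"
        using p(2)[OF w] pe[OF w] dist_triangle[of x "map_of_word w e" "map_of_word w (p w)"]
        by (simp add: algebra_simps)
      moreover have "map_of_word w e \<in> E" using map_of_word_E[OF I(1)[OF w]] e by blast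
      ultimately have "map_of_word w e \<in> cball x ((1 + D) * R) \<inter> E" by simp
      then have "map_of_word w e \<in> (\<Union>y\<in>F. cball y q)" by (rule subsetD[OF F(3)])
      then show "w \<in> (\<Union>y\<in>F. J y)" using w unfolding J_def by auto
    qed
    have fin: "finite (\<Union>y\<in>F. J y)" using F(1) J by blast
    have "card I \<le> card (\<Union>y\<in>F. J y)" using fin IJ by (rule card_mono)
    also have "\<dots> \<le> (\<Sum>y\<in>F. card (J y))" using F(1) by (rule card_UN_le)
    also have "\<dots> \<le> (\<Sum>y\<in>F. M)" using J by (intro sum_mono) blast
    finally have "card I \<le> card F * M" by simp
    then have "real (card I) \<le> real (card F) * real M"
      by (metis of_nat_le_iff of_nat_mult)
    also have "\<dots> \<le> (c * ((1 + D) powr t * (R / q) powr t)) * real M"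
      using F(2) by (intro mult_right_mono) auto
    finally show ?thesis
      unfolding I_def[symmetric] using finite_subset[OF IJ fin] by (simp add: algebra_simps)
  qed
  then show ?thesis
    using c by (intro exI[of _ "c * (1 + D) powr t * real M"]) auto
qed

section \<open>Covering the inhomogeneous set\<close>

text \<open>By scaling, covering a copy of \<open>C\<close> at radius \<open>r\<close> amounts to
  covering \<open>C\<close> at radius \<open>r / ratio w\<close>.\<close>

lemma covered_map_of_word_C:
  assumes "w \<in> words" "covered S C (r / ratio w) k"
  shows "covered (map_of_word w ` S) K r k"
proof (rule covered_mono)
  show "covered (map_of_word w ` S) (map_of_word w ` C) (ratio w * (r / ratio w)) k"
    using assms ratio_pos[OF assms(1)]
    by (intro covered_similitude_image dist_map_of_word) auto
  show "map_of_word w ` C \<subseteq> K"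
    using map_of_word_K[OF assms(1)] C_subset_K by blast
qed (use ratio_pos[OF assms(1)] in auto)

text \<open>The ball is split into points near \<open>E\<close>, copies of \<open>C\<close> of ratio
  above \<open>R\<close>, and smaller copies sorted into dyadic levels. The gap
  \<open>t' < t\<close> makes the costs of the levels decay geometrically.\<close>

lemma uniform_exponent_K:
  assumes "uniform_exponent E t'" "uniform_exponent C t" "t' < t" "0 \<le> t"
  shows "uniform_exponent K t"
proof -
  obtain cE where cE: "cE \<ge> 1"
    and covE: "\<And>x r R. 0 < r \<Longrightarrow> r \<le> R \<Longrightarrow> covered (cball x R \<inter> E) E r (cE * (R / r) powr t)"
    using uniform_exponent_mono[OF assms(1) less_imp_le[OF assms(3)]]
    unfolding uniform_exponent_def by blast
  obtain cC where cC: "cC \<ge> 1"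
    and covC: "\<And>x r R. 0 < r \<Longrightarrow> r \<le> R \<Longrightarrow> covered (cball x R \<inter> C) C r (cC * (R / r) powr t)"
    using assms(2) unfolding uniform_exponent_def by blast
  obtain M where M: "\<forall>x R. 0 < R \<longrightarrow> finite {w \<in> hitting_words x R. R < ratio w} \<and>
       card {w \<in> hitting_words x R. R < ratio w} \<le> M"
    using card_large_hitting_words by blast
  obtain N where N: "0 \<le> N" "\<forall>x R q. 0 < q \<and> q \<le> R \<longrightarrow>
    finite {w \<in> hitting_words x R. q / 2 < ratio w \<and> ratio w \<le> q} \<and>
    real (card {w \<in> hitting_words x R. q / 2 < ratio w \<and> ratio w \<le> q}) \<le> N * (R / q) powr t'"
    using card_hitting_words[OF assms(1)] by blast
  obtain c0 where c0: "c0 \<in> C" using C_nonempty by blast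
  define \<theta> :: real where "\<theta> = 2 powr (t' - t)"
  have \<theta>: "0 < \<theta>" "\<theta> < 1"
    using assms(3) powr_less_one[of 2 "t' - t"] by (auto simp: \<theta>_def)
  \<comment> \<open>The three summands are the costs of the three parts, the last being a geometric
    series.\<close>
  define b where
    "b = cE * (2 * (1 + D)) powr t + real M * (cC * 2 powr t) + N * cC * (1 + D) powr t / (1 - \<theta>)"
  have "covered (cball x R \<inter> K) K r (b * (R / r) powr t)" if r: "0 < r" "r \<le> R" for x r R
  proof -
    define P where "P = (R / r) powr t"
    \<comment> \<open>This choice gives \<open>D * s + s = r\<close>: a point within
      \<open>D * s\<close> of \<open>E\<close> is reached by enlarging balls of radius
      \<open>s\<close> to radius \<open>r\<close>.\<close>
    define s where "s = r / (1 + D)"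
    have R: "0 < R" using r by simp
    have "0 < s" "s * (1 + D) = r"
      using r D_ge_1 by (auto simp: s_def)
    then have s: "0 < s" "D * s + s = r" "D * s \<le> R" "s \<le> r"
      using r D_ge_1 by (auto simp: algebra_simps)
    have E_part: "covered {z. dist x z \<le> R \<and> (\<exists>e\<in>E. dist z e \<le> D * s)} K r
        (cE * (2 * (1 + D)) powr t * P)"
    proof -
      \<comment> \<open>The nearby point of \<open>E\<close> may leave the ball, but since
        \<open>D * s \<le> R\<close> it stays within \<open>2 * R\<close> of
        \<open>x\<close>.\<close>
      have "2 * R / s = 2 * (1 + D) * (R / r)"
        using D_ge_1 r by (simp add: s_def)
      then have "(2 * R / s) powr t = (2 * (1 + D)) powr t * P"
        using powr_mult[of "2 * (1 + D)" "R / r" t] r D_ge_1 by (simp add: P_def)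
      then obtain F where F: "finite F" "F \<subseteq> E" "real (card F) \<le> cE * (2 * (1 + D)) powr t * P"
        "cball x (2 * R) \<inter> E \<subseteq> (\<Union>y\<in>F. cball y s)"
        using covE[of s "2 * R" x] s r unfolding covered_def by (auto simp: mult.assoc)
      have "{z. dist x z \<le> R \<and> (\<exists>e\<in>E. dist z e \<le> D * s)} \<subseteq> (\<Union>y\<in>F. cball y r)"
      proof
        fix z assume "z \<in> {z. dist x z \<le> R \<and> (\<exists>e\<in>E. dist z e \<le> D * s)}"
        then obtain e where e: "dist x z \<le> R" "e \<in> E" "dist z e \<le> D * s" by blast
        then have "dist x e \<le> 2 * R"
          using dist_triangle[of x e z] s by linarith
        then obtain y where y: "y \<in> F" "dist y e \<le> s" using F(4) e(2) by force
        then have "dist y z \<le> r"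
          using dist_triangle2[of y z e] e s by linarith
        then show "z \<in> (\<Union>y\<in>F. cball y r)" using y by auto
      qed
      moreover have "F \<subseteq> K" using F(2) E_subset_K by blast
      ultimately show ?thesis
        unfolding covered_def using F(1,3) by (intro exI[of _ F]) simp
    qed
    define L where "L = {w \<in> hitting_words x R. R < ratio w}"
    have L_part: "covered (\<Union>w\<in>L. map_of_word w ` C \<inter> cball x R) K r (real M * (cC * 2 powr t * P))"
    proof (rule covered_UN)
      show "finite L" "real (card L) \<le> real M" using M R by (auto simp: L_def)
      show "0 \<le> cC * 2 powr t * P" using cC by (simp add: P_def)
      fix w assume "w \<in> L"
      then obtain a where w: "w \<in> words" and a: "a \<in> C" "dist x (map_of_word w a) \<le> R"
        by (auto simp: L_def hitting_words_def)
      \<comment> \<open>Two points of the copy in the ball are at most \<open>2 * R\<close> apart,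
        so only the part of \<open>C\<close> within \<open>2 * R / ratio w\<close> of
        \<open>a\<close> matters. Its cost does not depend on the ratio.\<close>
      define S where "S = cball a (2 * R / ratio w) \<inter> C"
      have "covered S C (r / ratio w) (cC * (2 * R / ratio w / (r / ratio w)) powr t)"
        unfolding S_def using r ratio_pos[OF w] by (intro covC) (auto simp: divide_right_mono)
      moreover have "(2 * R / ratio w / (r / ratio w)) powr t = 2 powr t * P"
        using powr_mult[of 2 "R / r" t] r ratio_pos[OF w] by (simp add: P_def)
      ultimately have "covered (map_of_word w ` S) K r (cC * 2 powr t * P)"
        using w by (intro covered_map_of_word_C) (auto simp: mult.assoc)
      moreover have "map_of_word w ` C \<inter> cball x R \<subseteq> map_of_word w ` S"
      proof
        fix z assume "z \<in> map_of_word w ` C \<inter> cball x R"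
        then obtain y where y: "y \<in> C" "z = map_of_word w y" "dist x z \<le> R" by auto
        have "ratio w * dist a y \<le> 2 * R"
          using a y dist_triangle3[of "map_of_word w a" z x] dist_map_of_word[OF w, of a y] by simp
        then have "y \<in> S"
          using y ratio_pos[OF w] by (simp add: S_def field_simps)
        then show "z \<in> map_of_word w ` S" using y by blast
      qed
      ultimately show "covered (map_of_word w ` C \<inter> cball x R) K r (cC * 2 powr t * P)"
        by (rule covered_mono) auto
    qed
    \<comment> \<open>Level \<open>n\<close> holds the words of ratio comparable to
      \<open>R / 2 ^ n\<close>; those of ratio at most \<open>s\<close> are already absorbed by the
      neighbourhood of \<open>E\<close>.\<close>
    define W where "W n = {w \<in> hitting_words x R.
        R / 2 ^ n / 2 < ratio w \<and> ratio w \<le> R / 2 ^ n \<and> s < ratio w}" for n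
    have W_part: "covered (\<Union>w\<in>W n. map_of_word w ` C \<inter> cball x R) K r
        (N * cC * (1 + D) powr t * P * \<theta> ^ n)" for n
    proof -
      define V where "V = {w \<in> hitting_words x R. R / 2 ^ n / 2 < ratio w \<and> ratio w \<le> R / 2 ^ n}"
      have "finite V \<and> real (card V) \<le> N * (R / (R / 2 ^ n)) powr t'"
        unfolding V_def using R by (intro N(2)[rule_format]) (simp add: field_simps)
      moreover have "W n \<subseteq> V" by (auto simp: W_def V_def)
      ultimately have W: "finite (W n)" "real (card (W n)) \<le> N * (2 ^ n) powr t'"
        using R finite_subset[of "W n" V] card_mono[of V "W n"] by auto
      have "covered (\<Union>w\<in>W n. map_of_word w ` C \<inter> cball x R) K r
          ((N * (2 ^ n) powr t') * (cC * ((1 + D) * (R / 2 ^ n) / r) powr t))"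
      proof (rule covered_UN[OF W])
        show "0 \<le> cC * ((1 + D) * (R / 2 ^ n) / r) powr t" using cC by simp
        fix w assume "w \<in> W n"
        then have w: "w \<in> words" "ratio w \<le> R / 2 ^ n" "s < ratio w"
          by (auto simp: W_def hitting_words_def)
        have pos: "0 < ratio w" using ratio_pos[OF w(1)] .
        \<comment> \<open>The ball of radius \<open>1 + D\<close> about \<open>c0\<close> contains
          all of \<open>C\<close>, and \<open>s < ratio w\<close> makes that radius large enough for
          \<open>covC\<close>.\<close>
        have "r / ratio w \<le> 1 + D"
          using w(3) pos D_ge_1 by (simp add: s_def field_simps)
        then have "covered (cball c0 (1 + D) \<inter> C) C (r / ratio w) (cC * ((1 + D) / (r / ratio w)) powr t)"
          using r pos by (intro covC) auto
        moreover have "cball c0 (1 + D) \<inter> C = C"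
          using dist_K[of c0] c0 C_subset_K by force
        moreover have "((1 + D) / (r / ratio w)) powr t \<le> ((1 + D) * (R / 2 ^ n) / r) powr t"
        proof (rule powr_mono2)
          have "(1 + D) / (r / ratio w) = (1 + D) * ratio w / r" by simp
          also have "\<dots> \<le> (1 + D) * (R / 2 ^ n) / r"
            using w(2) D_ge_1 r by (intro divide_right_mono mult_left_mono) auto
          finally show "(1 + D) / (r / ratio w) \<le> (1 + D) * (R / 2 ^ n) / r" .
        qed (use assms(4) D_ge_1 r pos in auto)
        ultimately have "covered C C (r / ratio w) (cC * ((1 + D) * (R / 2 ^ n) / r) powr t)"
          using cC by (auto elim!: covered_mono)
        then have "covered (map_of_word w ` C) K r (cC * ((1 + D) * (R / 2 ^ n) / r) powr t)"
          using w(1) by (rule covered_map_of_word_C[rotated])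
        then show "covered (map_of_word w ` C \<inter> cball x R) K r (cC * ((1 + D) * (R / 2 ^ n) / r) powr t)"
          by (rule covered_mono) auto
      qed
      \<comment> \<open>The number of words grows like \<open>2 powr (n * t')\<close>, while the
        cost of each decays like \<open>2 powr (- n * t)\<close>.\<close>
      moreover have "(2 ^ n) powr t' * ((1 + D) * (R / 2 ^ n) / r) powr t = (1 + D) powr t * P * \<theta> ^ n"
      proof -
        have "(1 + D) * (R / 2 ^ n) / r = (1 + D) * (R / r) / 2 ^ n" by simp
        then have "((1 + D) * (R / 2 ^ n) / r) powr t = (1 + D) powr t * P / (2 ^ n) powr t"
          using D_ge_1 r by (simp only: P_def powr_divide powr_mult) 
        moreover have "(2 ^ n) powr t' / (2 ^ n) powr t = \<theta> ^ n"
        proof -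
          have "(2 ^ n) powr a = (2 powr a) ^ n" for a :: real
            by (simp add: powr_powr mult.commute flip: powr_realpow)
          then show ?thesis unfolding \<theta>_def by (simp add: powr_diff power_divide)
        qed
        ultimately show ?thesis
          by (metis (no_types, lifting) mult.commute times_divide_eq_right)
      qed
      ultimately show ?thesis
        by (simp add: mult.assoc mult.left_commute)
    qed
    \<comment> \<open>Then \<open>R / 2 ^ m < s\<close>, so \<open>m\<close> levels exhaust all
      words of ratio between \<open>s\<close> and \<open>R\<close>.\<close>
    obtain m where m: "(1 / 2) ^ m < s / R"
      using real_arch_pow_inv[of "s / R" "1 / 2"] s R by auto
    have WW: "covered (\<Union>n\<in>{..<m}. \<Union>w\<in>W n. map_of_word w ` C \<inter> cball x R) K r
        (N * cC * (1 + D) powr t * P / (1 - \<theta>))"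
    proof (rule covered_mono)
      show "covered (\<Union>n\<in>{..<m}. \<Union>w\<in>W n. map_of_word w ` C \<inter> cball x R) K r
        (\<Sum>n<m. N * cC * (1 + D) powr t * P * \<theta> ^ n)"
        by (rule covered_UN_sum[OF finite_lessThan]) (rule W_part)
      \<comment> \<open>The bound must not depend on \<open>m\<close>, which varies with
        \<open>R / r\<close>.\<close>
      have "(\<Sum>n<m. \<theta> ^ n) = (1 - \<theta> ^ m) / (1 - \<theta>)"
        using \<theta> by (simp add: sum_gp_strict)
      also have "\<dots> \<le> 1 / (1 - \<theta>)"
        using \<theta> by (intro divide_right_mono) auto
      finally have "N * cC * (1 + D) powr t * P * (\<Sum>n<m. \<theta> ^ n)
          \<le> N * cC * (1 + D) powr t * P * (1 / (1 - \<theta>))"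
        using N(1) cC by (intro mult_left_mono) (auto simp: P_def)
      then show "(\<Sum>n<m. N * cC * (1 + D) powr t * P * \<theta> ^ n)
          \<le> N * cC * (1 + D) powr t * P / (1 - \<theta>)"
        by (simp add: sum_distrib_left)
    qed auto
    have "cball x R \<inter> K \<subseteq> {z. dist x z \<le> R \<and> (\<exists>e\<in>E. dist z e \<le> D * s)}
        \<union> (\<Union>w\<in>L. map_of_word w ` C \<inter> cball x R)
        \<union> (\<Union>n\<in>{..<m}. \<Union>w\<in>W n. map_of_word w ` C \<inter> cball x R)"
    proof
      fix z assume z: "z \<in> cball x R \<inter> K"
      show "z \<in> {z. dist x z \<le> R \<and> (\<exists>e\<in>E. dist z e \<le> D * s)}
        \<union> (\<Union>w\<in>L. map_of_word w ` C \<inter> cball x R)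
        \<union> (\<Union>n\<in>{..<m}. \<Union>w\<in>W n. map_of_word w ` C \<inter> cball x R)"
      proof (cases "\<exists>e\<in>E. dist z e \<le> D * s")
        case True
        then show ?thesis using z by auto
      next
        case False
        then obtain w where w: "w \<in> words" "s < ratio w" "z \<in> map_of_word w ` C"
          using near_E_or_large_word[OF s(1), of z] z by blast
        then have hit: "w \<in> hitting_words x R" using z by (auto simp: hitting_words_def)
        show ?thesis
        proof (cases "R < ratio w")
          case True
          then have "w \<in> L" using hit by (simp add: L_def)
          then show ?thesis using w z by blast
        next
          case False
          \<comment> \<open>Minimality bounds the ratio by \<open>R / 2 ^ n\<close>; for
            \<open>n = 0\<close> the case assumption does. The level \<open>m - 1\<close> already
            satisfies the condition, whence \<open>n < m\<close>.\<close>
          define n where "n = (LEAST n. R / 2 ^ n / 2 < ratio w)"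
          have "(1 / 2) ^ m < ratio w / R"
            using m w(2) R by (smt (verit) divide_strict_right_mono)
          then have ex: "R / 2 ^ m < ratio w"
            using R by (simp add: power_one_over field_simps)
          have "m \<noteq> 0" using ex False by (intro notI) simp
          then have m1: "R / 2 ^ (m - 1) / 2 < ratio w"
            using ex by (cases m) (auto simp: field_simps)
          then have n1: "R / 2 ^ n / 2 < ratio w" unfolding n_def by (rule LeastI)
          have "n \<le> m - 1" unfolding n_def using m1 by (rule Least_le)
          then have "n < m" using \<open>m \<noteq> 0\<close> by simp
          have "ratio w \<le> R / 2 ^ n"
          proof (cases n)
            case 0
            then show ?thesis using False by simp
          next
            case (Suc k)
            then have "k < (LEAST n. R / 2 ^ n / 2 < ratio w)" by (simp only: n_def lessI)
            then have "\<not> R / 2 ^ k / 2 < ratio w" by (rule not_less_Least)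
            then show ?thesis using Suc by (simp add: field_simps)
          qed
          then have "w \<in> W n" using hit n1 w(2) by (simp add: W_def)
          then show ?thesis using \<open>n < m\<close> w z by blast
        qed
      qed
    qed
    moreover have "cE * (2 * (1 + D)) powr t * P + real M * (cC * 2 powr t * P)
        + N * cC * (1 + D) powr t * P / (1 - \<theta>) = b * P"
      by (simp add: b_def algebra_simps add_divide_distrib)
    ultimately show ?thesis
      using covered_mono[OF covered_Un[OF covered_Un[OF E_part L_part] WW]] P_def by force
  qed
  moreover have "1 \<le> b"
  proof -
    have "1 * 1 \<le> cE * (2 * (1 + D)) powr t"
      using cE D_ge_1 assms(4) by (intro mult_mono ge_one_powr_ge_zero) auto
    moreover have "0 \<le> real M * (cC * 2 powr t)" "0 \<le> N * cC * (1 + D) powr t / (1 - \<theta>)"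
      using cC N(1) \<theta> by auto
    ultimately show ?thesis by (simp add: b_def)
  qed
  ultimately show ?thesis
    unfolding uniform_exponent_def by (intro exI[of _ b] conjI allI impI) auto
qed

end

section \<open>Comparison of the dimensions of \<open>E\<^sub>C\<close>, \<open>E\<close> and
  \<open>C\<close>\<close>

theorem theorem4p1:
  fixes C E E\<^sub>C :: "(real ^ 'd) set"
    and \<phi> :: "nat \<Rightarrow> real ^ 'd \<Rightarrow> real ^ 'd"
    and \<kappa> :: nat
  assumes "compact C"
    and "similitude_IFS \<kappa> \<phi>"
    and "condensation_open_set_condition \<kappa> \<phi> C"
    and "self_similar_set \<kappa> \<phi> E"
    and "inhomogeneous_self_similar_set \<kappa> \<phi> C E\<^sub>C"
  shows "assouad_dim E\<^sub>C = max (assouad_dim E) (assouad_dim C)"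
proof (rule antisym)
  have comp: "compact E\<^sub>C" "compact E"
    using assms(4,5) unfolding self_similar_set_def inhomogeneous_self_similar_set_def by auto
  obtain \<rho> where "\<forall>i\<in>{1..\<kappa>}. 0 < \<rho> i \<and> \<rho> i < 1 \<and> (\<forall>x y. dist (\<phi> i x) (\<phi> i y) = \<rho> i * dist x y)"
    using assms(2) unfolding similitude_IFS_def contractive_similitude_def by metis
  then interpret similitudes \<kappa> \<phi> \<rho>
    by unfold_locales auto
  have K: "E\<^sub>C = (\<Union>i\<in>{1..\<kappa>}. \<phi> i ` E\<^sub>C) \<union> C" "E\<^sub>C \<noteq> {}"
    using assms(5) unfolding inhomogeneous_self_similar_set_def by auto
  have E: "E = (\<Union>i\<in>{1..\<kappa>}. \<phi> i ` E)" "E \<noteq> {}"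
    using assms(4) unfolding self_similar_set_def by blast+
  have E_sub: "E \<subseteq> E\<^sub>C"
    using assms(4) compact_imp_closed[OF comp(1)] K(2)
    by (rule self_similar_set_subset) (use K(1) in blast)
  have C_sub: "C \<subseteq> E\<^sub>C" using K(1) by blast
  show "max (assouad_dim E) (assouad_dim C) \<le> assouad_dim E\<^sub>C"
    using assouad_dim_mono[OF comp(1)] E_sub C_sub by simp
  show "assouad_dim E\<^sub>C \<le> max (assouad_dim E) (assouad_dim C)"
  proof (cases "C = {}")
    case True
    \<comment> \<open>Without condensation \<open>E\<^sub>C\<close> is itself self-similar, hence
      contained in the closed invariant set \<open>E\<close>.\<close>
    then have "self_similar_set \<kappa> \<phi> E\<^sub>C"
      using assms(5) unfolding self_similar_set_def inhomogeneous_self_similar_set_def by simp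
    then have "E\<^sub>C \<subseteq> E"
      using compact_imp_closed[OF comp(2)] E(2)
      by (rule self_similar_set_subset) (use E(1) in blast)
    then show ?thesis
      using assouad_dim_mono[OF comp(2)] by (auto intro: max.coboundedI1)
  next
    case False
    obtain U where U: "open U"
      "C \<subseteq> U - (\<Union>i\<in>{1..\<kappa>}. closure (\<phi> i ` U))"
      "\<forall>i\<in>{1..\<kappa>}. \<phi> i ` U \<subseteq> U"
      "\<forall>i\<in>{1..\<kappa>}. \<forall>j\<in>{1..\<kappa>}. i \<noteq> j \<longrightarrow> \<phi> i ` U \<inter> \<phi> j ` U = {}"
      using assms(3) unfolding condensation_open_set_condition_def by blast
    \<comment> \<open>The closures make this set open, so compactness of \<open>C\<close> yields one
      radius \<open>\<delta>\<close> for all its points.\<close>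
    have "open (U - (\<Union>i\<in>{1..\<kappa>}. closure (\<phi> i ` U)))"
      using U(1) by (intro open_Diff closed_UN) auto
    then obtain \<delta> where \<delta>: "\<delta> > 0" "(\<Union>c\<in>C. ball c \<delta>) \<subseteq> U - (\<Union>i\<in>{1..\<kappa>}. closure (\<phi> i ` U))"
      using compact_subset_open_imp_ball_epsilon_subset[OF assms(1) _ U(2)] by blast
    have ball: "ball c \<delta> \<subseteq> U - (\<Union>i\<in>{1..\<kappa>}. \<phi> i ` U)" if "c \<in> C" for c
    proof -
      have "(\<Union>i\<in>{1..\<kappa>}. \<phi> i ` U) \<subseteq> (\<Union>i\<in>{1..\<kappa>}. closure (\<phi> i ` U))"
        by (intro UN_mono closure_subset) simp
      then show ?thesis using \<delta>(2) that by blast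
    qed
    interpret condensation_sets \<kappa> \<phi> \<rho> C U \<delta> E "E\<^sub>C"
    proof unfold_locales
      show "\<phi> i ` U \<subseteq> U" if "i \<in> {1..\<kappa>}" for i
        using U(3) that by (rule bspec)
      show "\<phi> i ` U \<inter> \<phi> j ` U = {}" if "i \<in> {1..\<kappa>}" "j \<in> {1..\<kappa>}" "i \<noteq> j" for i j
        using U(4)[rule_format, OF that] .
    qed (rule \<delta>(1) ball assms(4,5) False, assumption?)+
    show ?thesis
    proof (rule ccontr)
      assume "\<not> ?thesis"
      then have "max (assouad_dim E) (assouad_dim C) < assouad_dim E\<^sub>C" by (simp only: not_le)
      \<comment> \<open>Two reals are interposed because \<open>uniform_exponent_K\<close> wants the
        exponent \<open>t'\<close> of \<open>E\<close> strictly below the exponent \<open>t\<close>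
        of \<open>C\<close>.\<close>
      from ereal_dense2[OF this] obtain t
        where t: "max (assouad_dim E) (assouad_dim C) < ereal t" "ereal t < assouad_dim E\<^sub>C"
        by (elim exE conjE)
      from ereal_dense2[OF t(1)] obtain t'
        where t': "max (assouad_dim E) (assouad_dim C) < ereal t'" "t' < t"
        by auto
      have "uniform_exponent E t'"
        using t'(1) by (intro uniform_exponent_if_assouad_dim_less[OF comp(2)]) simp
      moreover have "uniform_exponent C t" "0 \<le> t"
        using t(1) uniform_exponent_if_assouad_dim_less[OF assms(1)] by auto
      ultimately have "uniform_exponent E\<^sub>C t"
        using t'(2) by (intro uniform_exponent_K)
      then show False
        using assouad_dim_le[of "E\<^sub>C" t] \<open>0 \<le> t\<close> t(2) by simp
    qed
  qed
qed

end
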